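(* Let $\Theta$ be a separable Hausdorff topological space with countable base, let $(P_\theta)_{\theta\in\Theta}$ be a family of measures on a measurable space $\mathcal{X}$, let $\theta^*\in\Theta$ be such that $P^*:=P_{\theta^*}$ is a probability measure, and let $(X_n)_{n\in\mathbb{N}}$ be i.i.d. random variables on a probability space $(\Omega,\mathcal{F},\mathbb{P})$ with values in $\mathcal{X}$ and common law $P^*$. Let $m:\Theta\times\mathcal{X}\to\mathbb{R}$ be such that $m_\theta:=m(\theta,\cdot)$ is measurable for every $\theta\in\Theta$. Assume that $\Theta$ is compact and that: (A1) for $P^*$-almost all $x\in\mathcal{X}$, the map $\theta\mapsto m(\theta,x)$ is continuous on $\Theta$; (A2) there exists a continuous map $a^*:\Theta\to\Theta$ (which may depend on $\theta^*$) such that for any $\theta\in\Theta$ with $\theta\neq\theta^*$, there exists a neighborhood $V\subset\Theta$ of $\theta$ for which the function $x\mapsto\sup_{\theta'\in V}\bigl(m(\theta',x)-m(a^*(\theta'),x)\bigr)$ belongs to $\mathrm{L}^1_+(\mathcal{X},P^* )$, and $P^*\bigl(m_\theta-m_{a^*(\theta)}\bigr)<0$. Then any sequence $(\widehat{\theta}_n)_n$ of asymptotic M-estimators is strongly consistent, that is, $\mathbb{P}$-almost surely $\lim_{n\to+\infty}\widehat{\theta}_n=\theta^*$.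
   Context: For a probability measure $P$ on $\mathcal{X}$, $\mathrm{L}^1_+(\mathcal{X},P)$ denotes the set of random variables (measurable functions) $Z$ on $\mathcal{X}$ such that $Z^+:=\max(Z,0)\in\mathrm{L}^1(\mathcal{X},P)$. For such $Z$, the expectation $P(Z):=P(Z^+)-P(Z^-)$, with $Z^-:=\max(-Z,0)$, makes sense in $\mathbb{R}\cup\{-\infty\}$. The first part of (A2) ensures that $m_\theta-m_{a^*(\theta)}\in\mathrm{L}^1_+(\mathcal{X},P^* )$, so that $P^*(m_\theta-m_{a^*(\theta)})$ has a meaning. For $n\geq1$, the random function $M_n:\Theta\to\mathbb{R}$ is $M_n(\theta):=\frac1n\sum_{i=1}^n m(\theta,X_i)$. A sequence $(\widehat{\theta}_n)_n$ of $\Theta$-valued random variables on $(\Omega,\mathcal{F},\mathbb{P})$, with $\widehat{\theta}_n$ measurable with respect to $\mathcal{F}_n:=\sigma(X_0,\ldots,X_n)$ for every $n$, is called a sequence of asymptotic M-estimators if $\mathbb{P}$-almost surely $\limsup_{n\to+\infty}\bigl(\sup_{\theta\in\Theta}M_n(\theta)-M_n(\widehat{\theta}_n)\bigr)=0$. A property holds $\mathbb{P}$-almost surely if it holds at every point of some event of $\mathbb{P}$-probability one. *)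

theory Defs
  imports "HOL-Probability.Probability"
begin

text \<open>Functions are extended-real valued, since a pointwise supremum of real functions may be
  infinite at some points. The map \<^const>\<open>e2ennreal\<close> truncates negative values to 0, so
  that \<open>e2ennreal (Z x)\<close> is the positive part of \<open>Z x\<close>.\<close>

definition L1_plus :: "'x measure \<Rightarrow> ('x \<Rightarrow> ereal) set" where
  "L1_plus P = {Z \<in> borel_measurable P. (\<integral>\<^sup>+ x. e2ennreal (Z x) \<partial>P) < \<infinity>}"

text \<open>The expectation of \<open>Z\<close> as positive part minus negative part. It is meaningful, with a value
  below infinity, for \<open>Z\<close> in \<^const>\<open>L1_plus\<close>.\<close>

definition ext_expectation :: "'x measure \<Rightarrow> ('x \<Rightarrow> ereal) \<Rightarrow> ereal" where
  "ext_expectation P Z =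
     enn2ereal (\<integral>\<^sup>+ x. e2ennreal (Z x) \<partial>P) - enn2ereal (\<integral>\<^sup>+ x. e2ennreal (- Z x) \<partial>P)"

definition empirical_criterion ::
  "('t \<Rightarrow> 'x \<Rightarrow> real) \<Rightarrow> (nat \<Rightarrow> 'o \<Rightarrow> 'x) \<Rightarrow> nat \<Rightarrow> 't \<Rightarrow> 'o \<Rightarrow> real" where
  "empirical_criterion m X n \<theta> \<omega> = (1 / real n) * (\<Sum>i = 1..n. m \<theta> (X i \<omega>))"

definition observed_sigma ::
  "'o measure \<Rightarrow> 'x measure \<Rightarrow> (nat \<Rightarrow> 'o \<Rightarrow> 'x) \<Rightarrow> nat \<Rightarrow> 'o measure" where
  "observed_sigma \<Omega> S X n =
     sigma (space \<Omega>) (\<Union>i\<in>{0..n}. {X i -` A \<inter> space \<Omega> | A. A \<in> sets S})"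

text \<open>The supremum over the whole parameter space is taken in the extended reals, as the empirical
  criterion need not be bounded above for every sample point.\<close>

definition asymptotic_M_estimators ::
  "'o measure \<Rightarrow> 'x measure \<Rightarrow> ('t::topological_space \<Rightarrow> 'x \<Rightarrow> real) \<Rightarrow> (nat \<Rightarrow> 'o \<Rightarrow> 'x) \<Rightarrow>
    (nat \<Rightarrow> 'o \<Rightarrow> 't) \<Rightarrow> bool" where
  "asymptotic_M_estimators \<Omega> S m X \<theta>h \<longleftrightarrow>
     (\<forall>n. \<theta>h n \<in> borel_measurable (observed_sigma \<Omega> S X n)) \<and>
     (AE \<omega> in \<Omega>. limsup (\<lambda>n. (SUP \<theta>. ereal (empirical_criterion m X n \<theta> \<omega>))
                          - ereal (empirical_criterion m X n (\<theta>h n \<omega>) \<omega>)) = 0)"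

end

theory Submission
  imports Defs
begin

text \<open>Near any parameter other than the target, continuity together with dominated convergence
  (positive parts) and Fatou's lemma (negative parts) provides a neighborhood \<open>U\<close> on which
  \<open>m \<theta> - m (a \<theta>) + c\<close> is dominated by a single function \<open>f\<close> of negative, possibly infinite,
  expectation, with \<open>c > 0\<close>. A random walk with steps \<open>f (X i)\<close> is almost surely bounded above, so that
  eventually each \<open>\<theta>\<close> in \<open>U\<close> is worse than \<open>a \<theta>\<close> for the empirical criterion by at least \<open>c / 2\<close>,
  and the estimators leave \<open>U\<close>. Compactness concludes. This one-sided bound on random walks
  replaces the strong law of large numbers.\<close>

section \<open>Running maxima of random walks\<close>

text \<open>This is the maximum of the partial sums of length at most \<open>n\<close>, the empty
  sum included. The recursion removes the first step, not the last, because under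
  \<open>stream_space\<close> the head is independent of the tail and the tail has the law of the
  whole stream.\<close>

primrec walk_max :: "('a \<Rightarrow> real) \<Rightarrow> nat \<Rightarrow> 'a stream \<Rightarrow> real" where
  "walk_max f 0 s = 0"
| "walk_max f (Suc n) s = max 0 (f (shd s) + walk_max f n (stl s))"

lemma walk_max_nonneg: "0 \<le> walk_max f n s"
  by (cases n) auto

lemma walk_max_mono: "walk_max f n s \<le> walk_max f (Suc n) s"
proof (induction n arbitrary: s)
  case (Suc n)
  show ?case using Suc[of "stl s"] by (simp add: max_def)
qed simp

lemma sum_le_walk_max: "(\<Sum>i<n. f (s !! i)) \<le> walk_max f n s"
proof (induction n arbitrary: s)
  case (Suc n)
  have "(\<Sum>i<Suc n. f (s !! i)) = f (shd s) + (\<Sum>i<n. f (stl s !! i))"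
    by (subst sum.lessThan_Suc_shift) simp
  then show ?case using Suc[of "stl s"] by simp
qed simp

lemma measurable_walk_max [measurable]:
  assumes [measurable]: "f \<in> borel_measurable M"
  shows "walk_max f n \<in> borel_measurable (stream_space M)"
proof (induction n)
  case 0
  then show ?case by (simp add: measurable_cong[of _ "walk_max f 0" "\<lambda>_. 0"])
next
  case (Suc n)
  note [measurable] = this
  show ?case by simp
qed

text \<open>Prepending \<open>x\<close> shifts every partial sum by the same number
  \<open>f x\<close>, so the supremum moves by a finite amount only. Unboundedness of the walk is
  therefore a shift-invariant event.\<close>

lemma SUP_ennreal_walk_max_Stream:
  "(SUP n. ennreal (walk_max f n (x ## s))) = top \<longleftrightarrow> (SUP n. ennreal (walk_max f n s)) = top"
proof
  assume *: "(SUP n. ennreal (walk_max f n (x ## s))) = top"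
  have "ennreal (walk_max f n (x ## s)) \<le> ennreal (f x) + (SUP n. ennreal (walk_max f n s))" for n
  proof -
    have "ennreal (walk_max f n (x ## s)) \<le> ennreal (walk_max f (Suc n) (x ## s))"
      by (intro ennreal_leI walk_max_mono)
    also have "\<dots> \<le> ennreal (max 0 (f x) + walk_max f n s)"
      using walk_max_nonneg[of f n s] by (intro ennreal_leI) auto
    also have "\<dots> = ennreal (f x) + ennreal (walk_max f n s)"
      using walk_max_nonneg[of f n s] by (auto simp: ennreal_plus max_def ennreal_neg)
    also have "\<dots> \<le> ennreal (f x) + (SUP n. ennreal (walk_max f n s))"
      by (intro add_left_mono SUP_upper) auto
    finally show ?thesis .
  qed
  then have "(SUP n. ennreal (walk_max f n (x ## s))) \<le> ennreal (f x) + (SUP n. ennreal (walk_max f n s))"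
    by (intro SUP_least)
  then show "(SUP n. ennreal (walk_max f n s)) = top"
    using * by (auto simp: top_unique)
next
  assume *: "(SUP n. ennreal (walk_max f n s)) = top"
  have "ennreal (walk_max f n s) \<le> ennreal (- f x) + (SUP n. ennreal (walk_max f n (x ## s)))" for n
  proof -
    have "ennreal (walk_max f n s) \<le> ennreal (max 0 (- f x) + walk_max f (Suc n) (x ## s))"
      by (intro ennreal_leI) auto
    also have "\<dots> = ennreal (- f x) + ennreal (walk_max f (Suc n) (x ## s))"
      using walk_max_nonneg[of f "Suc n" "x ## s"]
      by (subst ennreal_plus) (auto simp: max_def ennreal_neg simp del: walk_max.simps)
    also have "\<dots> \<le> ennreal (- f x) + (SUP n. ennreal (walk_max f n (x ## s)))"
      by (intro add_left_mono SUP_upper) auto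
    finally show ?thesis .
  qed
  then have "(SUP n. ennreal (walk_max f n s)) \<le> ennreal (- f x) + (SUP n. ennreal (walk_max f n (x ## s)))"
    by (intro SUP_least)
  then show "(SUP n. ennreal (walk_max f n (x ## s))) = top"
    using * by (auto simp: top_unique)
qed

text \<open>Here \<open>y\<close> is a new first step and \<open>w\<close> the maximum of the walk
  after it. A step \<open>y\<close> \<ge> 0 raises the maximum by \<open>y\<close>; a negative one
  lowers it by \<open>- y\<close>, but by no more than \<open>w\<close>, as the maximum stays
  nonnegative. The balance is written with sums only, to avoid subtraction in
  \<open>ennreal\<close>.\<close>

lemma ennreal_lindley_step:
  fixes w y :: real
  assumes "0 \<le> w"
  shows "ennreal (max 0 (y + w)) + ennreal (min w (- y)) = ennreal w + ennreal y"
proof (cases "y \<ge> 0")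
  case True
  then show ?thesis using assms by (simp add: ennreal_neg ennreal_plus add.commute)
next
  case False
  then show ?thesis using assms
    by (auto simp: ennreal_neg max_def min_def simp flip: ennreal_plus)
qed

text \<open>By the one-step balance, each additional step adds at most the integral of the positive
  part of \<open>f\<close>. Finiteness is what later permits cancelling the expected
  maximum.\<close>

lemma (in prob_space) nn_integral_walk_max_finite:
  assumes [measurable]: "f \<in> borel_measurable M" and fin: "(\<integral>\<^sup>+x. ennreal (f x) \<partial>M) < \<infinity>"
  shows "(\<integral>\<^sup>+s. ennreal (walk_max f n s) \<partial>stream_space M) < \<infinity>"
proof (induction n)
  case (Suc n)
  interpret S: prob_space "stream_space M" by (rule prob_space_stream_space)
  have "(\<integral>\<^sup>+s. ennreal (walk_max f (Suc n) s) \<partial>stream_space M)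
      = (\<integral>\<^sup>+x. \<integral>\<^sup>+s. ennreal (walk_max f (Suc n) (x ## s)) \<partial>stream_space M \<partial>M)"
    by (subst nn_integral_stream_space) auto
  also have "\<dots> \<le> (\<integral>\<^sup>+x. \<integral>\<^sup>+s. ennreal (f x) + ennreal (walk_max f n s) \<partial>stream_space M \<partial>M)"
  proof (intro nn_integral_mono)
    fix x s
    show "ennreal (walk_max f (Suc n) (x ## s)) \<le> ennreal (f x) + ennreal (walk_max f n s)"
      using ennreal_lindley_step[where w="walk_max f n s" and y="f x", OF walk_max_nonneg]
      by (metis add.commute le_iff_add stream.sel walk_max.simps(2))
  qed
  also have "\<dots> = (\<integral>\<^sup>+x. ennreal (f x) \<partial>M) + (\<integral>\<^sup>+s. ennreal (walk_max f n s) \<partial>stream_space M)"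
    by (simp add: nn_integral_add S.emeasure_space_1 emeasure_space_1)
  also have "\<dots> < \<infinity>" using Suc fin by simp
  finally show ?case .
qed simp

text \<open>On the shift-invariant event where the walk is unbounded, the expected maximum cannot decrease
  with the horizon; comparing two consecutive horizons shows that the drift is nonnegative there.\<close>

lemma (in prob_space) AE_walk_max_bounded:
  assumes [measurable]: "f \<in> borel_measurable M"
    and drift: "(\<integral>\<^sup>+x. ennreal (f x) \<partial>M) < (\<integral>\<^sup>+x. ennreal (- f x) \<partial>M)"
  shows "AE s in stream_space M. (SUP n. ennreal (walk_max f n s)) \<noteq> top"
proof -
  interpret S: prob_space "stream_space M" by (rule prob_space_stream_space)
  define p where "p = (\<integral>\<^sup>+x. ennreal (f x) \<partial>M)"
  define q where "q = (\<integral>\<^sup>+x. ennreal (- f x) \<partial>M)"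
  define A where "A = {s \<in> space (stream_space M). (SUP n. ennreal (walk_max f n s)) = top}"
  have [measurable]: "A \<in> sets (stream_space M)" unfolding A_def by measurable
  have A_Stream: "indicator A (x ## s) = (indicator A s :: ennreal)"
    if "x \<in> space M" "s \<in> space (stream_space M)" for x s
  proof -
    have "x ## s \<in> A \<longleftrightarrow> s \<in> A"
      using that unfolding A_def mem_Collect_eq SUP_ennreal_walk_max_Stream stream_space_Stream by blast
    then show ?thesis by (simp add: indicator_def)
  qed
  define e where "e n = (\<integral>\<^sup>+s. indicator A s * ennreal (walk_max f n s) \<partial>stream_space M)" for n
  \<comment> \<open>The loss term of the one-step balance, restricted to \<open>A\<close>.\<close>
  define r where "r n x s = indicator A s * ennreal (min (walk_max f n s) (- f x))" for n x s
  have p_fin: "p < \<infinity>" using drift unfolding p_def by (simp add: top.not_eq_extremum order.strict_trans2)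
  have e_fin: "e n < \<infinity>" for n
  proof -
    have "e n \<le> (\<integral>\<^sup>+s. ennreal (walk_max f n s) \<partial>stream_space M)"
      unfolding e_def by (intro nn_integral_mono) (auto simp: indicator_def)
    also have "\<dots> < \<infinity>"
      using nn_integral_walk_max_finite[of f n] p_fin by (simp add: p_def)
    finally show ?thesis .
  qed
  \<comment> \<open>Integrating the balance over \<open>A\<close> gives \<open>e (Suc n)\<close> +
    loss = \<open>e n\<close> + gain, where shift invariance makes the gain
    \<open>emeasure (stream_space M) A * p\<close>. Since \<open>e n\<close> \<le>
    \<open>e (Suc n)\<close> and \<open>e n\<close> is finite, the loss is at most the gain.\<close>
  have r_le: "(\<integral>\<^sup>+x. \<integral>\<^sup>+s. r n x s \<partial>stream_space M \<partial>M) \<le> emeasure (stream_space M) A * p" for n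
  proof -
    have "e n + (\<integral>\<^sup>+x. \<integral>\<^sup>+s. r n x s \<partial>stream_space M \<partial>M)
        \<le> e (Suc n) + (\<integral>\<^sup>+x. \<integral>\<^sup>+s. r n x s \<partial>stream_space M \<partial>M)"
      unfolding e_def by (intro add_right_mono nn_integral_mono mult_left_mono ennreal_leI walk_max_mono) auto
    also have "e (Suc n) = (\<integral>\<^sup>+x. \<integral>\<^sup>+s. indicator A (x ## s) * ennreal (walk_max f (Suc n) (x ## s)) \<partial>stream_space M \<partial>M)"
      unfolding e_def by (subst nn_integral_stream_space) auto
    also have "\<dots> = (\<integral>\<^sup>+x. \<integral>\<^sup>+s. indicator A s * ennreal (max 0 (f x + walk_max f n s)) \<partial>stream_space M \<partial>M)"
      by (intro nn_integral_cong) (simp add: A_Stream)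
    also have "\<dots> + (\<integral>\<^sup>+x. \<integral>\<^sup>+s. r n x s \<partial>stream_space M \<partial>M)
      = (\<integral>\<^sup>+x. \<integral>\<^sup>+s. indicator A s * (ennreal (max 0 (f x + walk_max f n s)) + ennreal (min (walk_max f n s) (- f x)))
           \<partial>stream_space M \<partial>M)"
      unfolding r_def
      by (simp add: nn_integral_add distrib_left S.borel_measurable_nn_integral)
    also have "\<dots> = (\<integral>\<^sup>+x. \<integral>\<^sup>+s. indicator A s * ennreal (walk_max f n s) + ennreal (f x) * indicator A s \<partial>stream_space M \<partial>M)"
      unfolding ennreal_lindley_step[OF walk_max_nonneg] by (simp add: distrib_left mult.commute)
    also have "\<dots> = e n + emeasure (stream_space M) A * p"
      by (simp add: nn_integral_add nn_integral_cmult nn_integral_multc e_def p_def emeasure_space_1 mult.commute)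
    finally show ?thesis
      using e_fin[of n] by (auto simp: ennreal_add_left_cancel_le)
  qed
  have r_mono: "r n x s \<le> r (Suc n) x s" for n x s
    unfolding r_def using walk_max_mono[of f n s]
    by (intro mult_left_mono ennreal_leI) (auto simp: min_le_iff_disj simp del: walk_max.simps)
  \<comment> \<open>On \<open>A\<close> the maximum eventually exceeds \<open>- f x\<close>, after
    which the cap in the loss is inactive and the whole negative part of \<open>f x\<close> is
    lost.\<close>
  have r_SUP: "(SUP n. r n x s) = indicator A s * ennreal (- f x)" for x s
  proof (cases "s \<in> A")
    case True
    then have "(SUP n. ennreal (walk_max f n s)) = top" unfolding A_def by blast
    then have "ennreal (- f x) < (SUP n. ennreal (walk_max f n s))" by (simp only: ennreal_less_top)
    then obtain n where "ennreal (- f x) < ennreal (walk_max f n s)" unfolding less_SUP_iff by auto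
    then have "- f x \<le> walk_max f n s" by (meson ennreal_leI leD le_cases)
    then have "r n x s = ennreal (- f x)" using True by (simp add: r_def min_absorb2)
    moreover have "r k x s \<le> ennreal (- f x)" for k
      using True by (auto simp: r_def intro!: ennreal_leI)
    ultimately show ?thesis using True
      by (intro antisym SUP_least) (auto intro: SUP_upper2[of n])
  qed (simp add: r_def)
  have r_meas [measurable]: "(\<lambda>(x, s). r n x s) \<in> borel_measurable (M \<Otimes>\<^sub>M stream_space M)" for n
    unfolding r_def by measurable
  have "emeasure (stream_space M) A * q = (\<integral>\<^sup>+x. \<integral>\<^sup>+s. indicator A s * ennreal (- f x) \<partial>stream_space M \<partial>M)"
    by (simp add: nn_integral_multc nn_integral_cmult q_def)
  also have "\<dots> = (\<integral>\<^sup>+x. \<integral>\<^sup>+s. (SUP n. r n x s) \<partial>stream_space M \<partial>M)"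
    by (simp add: r_SUP)
  also have "\<dots> = (\<integral>\<^sup>+x. (SUP n. \<integral>\<^sup>+s. r n x s \<partial>stream_space M) \<partial>M)"
    by (intro nn_integral_cong nn_integral_monotone_convergence_SUP)
       (auto intro!: incseq_SucI le_funI r_mono)
  also have "\<dots> = (SUP n. \<integral>\<^sup>+x. \<integral>\<^sup>+s. r n x s \<partial>stream_space M \<partial>M)"
    by (intro nn_integral_monotone_convergence_SUP incseq_SucI le_funI nn_integral_mono r_mono)
       measurable
  also have "\<dots> \<le> emeasure (stream_space M) A * p"
    by (intro SUP_least r_le)
  finally have le: "emeasure (stream_space M) A * q \<le> emeasure (stream_space M) A * p" .
  have "emeasure (stream_space M) A = 0"
  proof (rule ccontr)
    assume "emeasure (stream_space M) A \<noteq> 0"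
    then have "emeasure (stream_space M) A * p < emeasure (stream_space M) A * q"
      using drift by (intro ennreal_mult_strict_left_mono) (auto simp: p_def q_def zero_less_iff_neq_zero S.emeasure_eq_measure)
    with le show False by simp
  qed
  then show ?thesis
    by (subst AE_iff_measurable[OF \<open>A \<in> sets _\<close>]) (auto simp: A_def)
qed

text \<open>Independence and the common law make the law of the sequence \<open>X\<close> a product
  measure, so \<open>to_stream\<close> maps it to \<open>stream_space P\<close> and the bound on the
  walk can be pulled back. The drift condition compares two integrals, so the negative part may have
  infinite expectation.\<close>

lemma (in prob_space) AE_partial_sums_bounded_above:
  assumes indep: "indep_vars (\<lambda>_. S) X UNIV" and law: "\<And>n::nat. distr M S (X n) = P"
    and [measurable]: "f \<in> borel_measurable S"
    and drift: "(\<integral>\<^sup>+x. ennreal (f x) \<partial>P) < (\<integral>\<^sup>+x. ennreal (- f x) \<partial>P)"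
  shows "AE \<omega> in M. \<exists>C. \<forall>n. (\<Sum>i=1..n. f (X i \<omega>)) \<le> C"
proof -
  have X [measurable]: "X i \<in> measurable M S" for i
    using indep by (auto simp: indep_vars_def)
  have sets_P [measurable_cong]: "sets P = sets S" using law[of 0] by (metis sets_distr)
  interpret P: prob_space P unfolding law[of 0, symmetric] by (rule prob_space_distr) simp
  have "distr M (\<Pi>\<^sub>M i\<in>UNIV. S) (\<lambda>\<omega> i. X i \<omega>) = (\<Pi>\<^sub>M i\<in>UNIV. P)"
    using indep_vars_iff_distr_eq_PiM[of "UNIV :: nat set" X "\<lambda>_. S"]
    indep by (simp add: law restrict_UNIV)
  then have "stream_space P = distr (distr M (\<Pi>\<^sub>M i\<in>UNIV. S) (\<lambda>\<omega> i. X i \<omega>)) (stream_space P) to_stream"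
    using stream_space_eq_distr[of P] by simp
  also have "\<dots> = distr M (stream_space P) (\<lambda>\<omega>. to_stream (\<lambda>i. X i \<omega>))"
    by (subst distr_distr) (auto simp: comp_def intro!: measurable_PiM_single' measurable_space[OF X])
  finally have eq: "stream_space P = distr M (stream_space P) (\<lambda>\<omega>. to_stream (\<lambda>i. X i \<omega>))" .
  have T: "(\<lambda>\<omega>. to_stream (\<lambda>i. X i \<omega>)) \<in> measurable M (stream_space P)"
    by (rule measurable_stream_space2) (simp add: to_stream_def)
  have "AE s in stream_space P. (SUP n. ennreal (walk_max f n s)) \<noteq> top"
    by (rule P.AE_walk_max_bounded) (use drift in auto)
  then have "AE \<omega> in M. (SUP n. ennreal (walk_max f n (to_stream (\<lambda>i. X i \<omega>)))) \<noteq> top"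
    by (subst (asm) eq) (rule AE_distrD[OF T])
  then show ?thesis
  proof eventually_elim
    case (elim \<omega>)
    define s where "s = to_stream (\<lambda>i. X i \<omega>)"
    obtain C where C: "0 \<le> C" "(SUP n. ennreal (walk_max f n s)) = ennreal C"
      using elim by (cases "SUP n. ennreal (walk_max f n s)") (auto simp: s_def)
    \<comment> \<open>The stream starts at \<open>X 0\<close> while the criterion starts at
      \<open>X 1\<close>; the extra term depends on the sample point but not on
      \<open>n\<close>.\<close>
    have "(\<Sum>i=1..n. f (X i \<omega>)) \<le> C - f (X 0 \<omega>)" for n
    proof -
      have "(\<Sum>i=1..n. f (X i \<omega>)) + f (X 0 \<omega>) = (\<Sum>i<Suc n. f (s !! i))"
        unfolding sum.lessThan_Suc_shift by (simp add: s_def to_stream_def sum.atLeast1_atMost_eq)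
      also have "\<dots> \<le> walk_max f (Suc n) s" by (rule sum_le_walk_max)
      also have "\<dots> \<le> C"
      proof -
        have "ennreal (walk_max f (Suc n) s) \<le> ennreal C" unfolding C(2)[symmetric] by (intro SUP_upper UNIV_I)
        then show ?thesis using C(1) by (simp add: ennreal_le_iff del: walk_max.simps)
      qed
      finally show ?thesis by simp
    qed
    then show ?case by blast
  qed
qed

section \<open>Uniform negative drift on a neighborhood\<close>

lemma ext_expectation_neg_imp:
  assumes "(\<integral>\<^sup>+x. e2ennreal (Z x) \<partial>P) < \<infinity>" and "ext_expectation P Z < 0"
  shows "(\<integral>\<^sup>+x. e2ennreal (Z x) \<partial>P) < (\<integral>\<^sup>+x. e2ennreal (- Z x) \<partial>P)"
proof -
  have "enn2ereal p < enn2ereal q" if "enn2ereal p - enn2ereal q < 0" "p < \<infinity>" for p q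
    using that by (cases p; cases q) auto
  then show ?thesis
    using assms unfolding ext_expectation_def less_ennreal.rep_eq by blast
qed

text \<open>The supremum over a neighborhood is replaced by one over a countable dense subset of it:
  by continuity both agree almost everywhere, and only the latter is known to be measurable.\<close>

lemma negative_drift_near:
  fixes \<phi> :: "'t::second_countable_topology \<Rightarrow> 'x \<Rightarrow> real"
  assumes "prob_space P"
    and meas [measurable]: "\<And>\<theta>. \<phi> \<theta> \<in> borel_measurable P"
    and cont: "AE x in P. continuous_on UNIV (\<lambda>\<theta>. \<phi> \<theta> x)"
    and V: "\<theta> \<in> interior V" "(\<lambda>x. SUP \<theta>'\<in>V. ereal (\<phi> \<theta>' x)) \<in> L1_plus P"
    and neg: "ext_expectation P (\<lambda>x. ereal (\<phi> \<theta> x)) < 0"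
  obtains U f c where "open U" "\<theta> \<in> U" "f \<in> borel_measurable P" "0 < (c::real)"
    "(\<integral>\<^sup>+x. ennreal (f x) \<partial>P) < (\<integral>\<^sup>+x. ennreal (- f x) \<partial>P)"
    "AE x in P. \<forall>\<theta>'\<in>U. \<phi> \<theta>' x + c \<le> f x"
proof -
  interpret prob_space P by fact
  define Z where "Z x = (SUP \<theta>'\<in>V. ereal (\<phi> \<theta>' x))" for x
  have [measurable]: "Z \<in> borel_measurable P" and Z_int: "(\<integral>\<^sup>+x. e2ennreal (Z x) \<partial>P) < \<infinity>"
    using V(2) by (auto simp: L1_plus_def Z_def[abs_def])
  have Z_ge: "ereal (\<phi> t x) \<le> Z x" if "t \<in> V" for t x
    using that by (auto simp: Z_def intro: SUP_upper)
  have Z_fin: "AE x in P. Z x \<noteq> \<infinity>"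
  proof -
    have "AE x in P. e2ennreal (Z x) \<noteq> \<infinity>"
      using Z_int by (intro nn_integral_noteq_infinite) auto
    then show ?thesis by eventually_elim auto
  qed
  obtain A where A: "\<And>i::nat. open (A i)" "\<And>i. \<theta> \<in> A i"
      "\<And>S. open S \<Longrightarrow> \<theta> \<in> S \<Longrightarrow> eventually (\<lambda>i. A i \<subseteq> S) sequentially"
    by (rule countable_basis_at_decseq[of \<theta>]) blast
  obtain D :: "'t set" where D: "countable D" "\<And>X. open X \<Longrightarrow> X \<noteq> {} \<Longrightarrow> \<exists>d\<in>D. d \<in> X"
    by (metis countable_dense_setE)
  \<comment> \<open>The sets shrink to the point, which gives convergence, and stay inside
    \<open>V\<close>, which gives domination by \<open>Z\<close>.\<close>
  define U where "U k = A k \<inter> interior V" for k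
  have U: "open (U k)" "\<theta> \<in> U k" "U k \<subseteq> V" "U k \<subseteq> A k" for k
    using A V(1) interior_subset[of V] by (auto simp: U_def)
  define h where "h k x = (SUP t\<in>D \<inter> U k. ereal (\<phi> t x))" for k x
  have [measurable]: "h k \<in> borel_measurable P" for k
    unfolding h_def using D(1) by (intro borel_measurable_SUP) auto
  have h_le_Z: "h k x \<le> Z x" for k x
    unfolding h_def using U(3) by (intro SUP_least Z_ge) auto
  have h_ge: "ereal (\<phi> t x) \<le> h k x"
    if x: "continuous_on UNIV (\<lambda>\<theta>. \<phi> \<theta> x)" and t: "t \<in> U k" for k x t
  proof (rule ccontr)
    assume "\<not> ereal (\<phi> t x) \<le> h k x"
    then have "t \<in> {t. h k x < ereal (\<phi> t x)} \<inter> U k" using t by auto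
    moreover have "open ({t. h k x < ereal (\<phi> t x)} \<inter> U k)"
      using x by (intro open_Int U open_Collect_less continuous_intros)
    ultimately obtain d where "d \<in> D" "h k x < ereal (\<phi> d x)" "d \<in> U k" using D(2) by fastforce
    moreover have "ereal (\<phi> d x) \<le> h k x" if "d \<in> D" "d \<in> U k"
      using that unfolding h_def by (intro SUP_upper) auto
    ultimately show False by auto
  qed
  \<comment> \<open>The vanishing margin \<open>1 / Suc k\<close> does not affect the limit and
    becomes the constant \<open>c\<close> in the end. Almost everywhere \<open>h k x\<close> lies
    between a real number and \<open>Z x\<close> < \<infinity>, so \<open>real_of_ereal\<close>
    replaces an infinite value by 0 only on a null set.\<close>
  define f where "f k x = real_of_ereal (h k x) + 1 / Suc k" for k x
  have [measurable]: "f k \<in> borel_measurable P" for k unfolding f_def by measurable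
  have good: "AE x in P. continuous_on UNIV (\<lambda>\<theta>. \<phi> \<theta> x) \<and> Z x \<noteq> \<infinity>"
    using cont Z_fin by eventually_elim auto
  have h_real: "ereal (real_of_ereal (h k x)) = h k x"
    if "continuous_on UNIV (\<lambda>\<theta>. \<phi> \<theta> x) \<and> Z x \<noteq> \<infinity>" for k x
    using h_ge[of x \<theta> k] h_le_Z[of k x] U(2)[of k] that by (cases "h k x") auto
  have f_lim: "(\<lambda>k. f k x) \<longlonglongrightarrow> \<phi> \<theta> x"
    if x: "continuous_on UNIV (\<lambda>\<theta>. \<phi> \<theta> x) \<and> Z x \<noteq> \<infinity>" for x
  proof -
    have "(\<lambda>k. real_of_ereal (h k x)) \<longlonglongrightarrow> \<phi> \<theta> x"
    proof (rule order_tendstoI)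
      fix b assume b: "b < \<phi> \<theta> x"
      have "b < real_of_ereal (h k x)" for k
        using h_ge[of x \<theta> k] U(2)[of k] x b h_real[OF x, of k]
        by (metis ereal_less_eq(3) order.strict_trans2)
      then show "\<forall>\<^sub>F k in sequentially. b < real_of_ereal (h k x)" by simp
    next
      fix b assume "\<phi> \<theta> x < b"
      then obtain b' where b': "\<phi> \<theta> x < b'" "b' < b" using dense by blast
      have "\<forall>\<^sub>F k in sequentially. A k \<subseteq> {t. \<phi> t x < b'}"
        using x b' by (intro A open_Collect_less continuous_intros) auto
      then show "\<forall>\<^sub>F k in sequentially. real_of_ereal (h k x) < b"
      proof eventually_elim
        case (elim k)
        have "h k x \<le> ereal b'"
          unfolding h_def using elim U(4)[of k] by (intro SUP_least) (auto intro!: less_imp_le)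
        then have "real_of_ereal (h k x) \<le> b'" using h_real[OF x, of k] by (metis ereal_less_eq(3))
        then show ?case using b' by simp
      qed
    qed
    then have "(\<lambda>k. f k x) \<longlonglongrightarrow> \<phi> \<theta> x + 0"
      unfolding f_def by (intro tendsto_add LIMSEQ_Suc lim_1_over_n[THEN LIMSEQ_Suc])
    then show ?thesis by simp
  qed
  define p where "p = (\<integral>\<^sup>+x. ennreal (\<phi> \<theta> x) \<partial>P)"
  define q where "q = (\<integral>\<^sup>+x. ennreal (- \<phi> \<theta> x) \<partial>P)"
  have "p \<le> (\<integral>\<^sup>+x. e2ennreal (Z x) \<partial>P)"
    unfolding p_def
  proof (intro nn_integral_mono)
    fix x
    show "ennreal (\<phi> \<theta> x) \<le> e2ennreal (Z x)"
      using e2ennreal_mono[OF Z_ge[of \<theta> x]] V(1) interior_subset by auto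
  qed
  then have "p < \<infinity>" using Z_int by (rule order.strict_trans1)
  then have "p < q"
    using ext_expectation_neg_imp[of P "\<lambda>x. ereal (\<phi> \<theta> x)"] neg by (simp add: p_def q_def)
  \<comment> \<open>A level between the two limits separates the integrals for large
    \<open>k\<close>, also when \<open>q\<close> is infinite.\<close>
  then obtain r where r: "p < r" "r < q" using dense by blast
  have "(\<lambda>k. \<integral>\<^sup>+x. ennreal (f k x) \<partial>P) \<longlonglongrightarrow> p"
    unfolding p_def
  \<comment> \<open>The bound holds because \<open>h k\<close> \<le> \<open>Z\<close> and the margin
    is at most 1.\<close>
  proof (rule nn_integral_dominated_convergence[where w="\<lambda>x. e2ennreal (Z x) + 1"])
    fix k
    have "ennreal (f k x) \<le> e2ennreal (Z x) + 1" for x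
    proof -
      have "ennreal (f k x) \<le> ennreal (real_of_ereal (h k x)) + ennreal (1 / Suc k)"
        unfolding f_def
      proof (cases "0 \<le> real_of_ereal (h k x)")
        case False
        then have "ennreal (real_of_ereal (h k x) + 1 / Suc k) \<le> ennreal (1 / Suc k)"
          by (intro ennreal_leI) linarith
        then show "ennreal (real_of_ereal (h k x) + 1 / Suc k)
            \<le> ennreal (real_of_ereal (h k x)) + ennreal (1 / Suc k)"
          by (rule order.trans) simp
      qed simp
      also have "\<dots> \<le> e2ennreal (h k x) + ennreal 1"
        by (intro add_mono ennreal_leI) (cases "h k x"; auto simp: e2ennreal_neg)+
      also have "\<dots> \<le> e2ennreal (Z x) + 1"
        using e2ennreal_mono[OF h_le_Z] by (intro add_mono) auto
      finally show ?thesis .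
    qed
    then show "AE x in P. ennreal (f k x) \<le> e2ennreal (Z x) + 1" by simp
  next
    show "(\<integral>\<^sup>+x. e2ennreal (Z x) + 1 \<partial>P) < \<infinity>"
      using Z_int by (subst nn_integral_add) (auto simp: emeasure_space_1)
    show "AE x in P. (\<lambda>k. ennreal (f k x)) \<longlonglongrightarrow> ennreal (\<phi> \<theta> x)"
      using good by eventually_elim (intro tendsto_ennrealI f_lim)
  qed measurable
  then have ev_p: "\<forall>\<^sub>F k in sequentially. (\<integral>\<^sup>+x. ennreal (f k x) \<partial>P) < r"
    using r(1) by (rule order_tendstoD)
  \<comment> \<open>Nothing dominates the negative parts, but a lower bound on their integrals
    suffices, and Fatou's lemma supplies it.\<close>
  have "q = (\<integral>\<^sup>+x. liminf (\<lambda>k. ennreal (- f k x)) \<partial>P)"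
    unfolding q_def
  proof (rule nn_integral_cong_AE)
    show "AE x in P. ennreal (- \<phi> \<theta> x) = liminf (\<lambda>k. ennreal (- f k x))"
      using good
      by eventually_elim (intro lim_imp_Liminf[symmetric] tendsto_ennrealI tendsto_minus f_lim, auto)
  qed
  also have "\<dots> \<le> liminf (\<lambda>k. \<integral>\<^sup>+x. ennreal (- f k x) \<partial>P)"
    by (rule nn_integral_liminf) measurable
  finally have "\<forall>\<^sub>F k in sequentially. r < (\<integral>\<^sup>+x. ennreal (- f k x) \<partial>P)"
    using r(2) by (intro less_LiminfD) (rule order.strict_trans2)
  with ev_p have "\<forall>\<^sub>F k in sequentially. (\<integral>\<^sup>+x. ennreal (f k x) \<partial>P) < (\<integral>\<^sup>+x. ennreal (- f k x) \<partial>P)"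
    by eventually_elim (rule order.strict_trans)
  then obtain k where k: "(\<integral>\<^sup>+x. ennreal (f k x) \<partial>P) < (\<integral>\<^sup>+x. ennreal (- f k x) \<partial>P)"
    by (auto simp: eventually_sequentially)
  show thesis
  proof (rule that[OF U(1,2)[of k] _ _ k, of "1 / Suc k"])
    show "AE x in P. \<forall>t\<in>U k. \<phi> t x + 1 / real (Suc k) \<le> f k x"
      using good
    proof eventually_elim
      case (elim x)
      show ?case
        using h_ge[of x _ k] elim h_real[OF elim, of k] unfolding f_def
        by (metis add_le_cancel_right ereal_less_eq(3))
    qed
  qed (auto intro: \<open>f k \<in> borel_measurable P\<close>)
qed

section \<open>From negative drift to convergence\<close>

text \<open>A pathwise argument with \<open>a t\<close> as competitor of \<open>t\<close>: dividing
  the bounded sum by \<open>n\<close> shows that \<open>t\<close> in \<open>U\<close> falls short of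
  \<open>a t\<close> by at least \<open>c - C / n\<close>. Half of \<open>c\<close> absorbs
  \<open>C / n\<close>; the other half contradicts the vanishing gap to the supremum.\<close>

lemma eventually_maximizer_notin:
  fixes m :: "'t::topological_space \<Rightarrow> 'x \<Rightarrow> real"
  assumes lim: "limsup (\<lambda>n. (SUP \<theta>. ereal (empirical_criterion m X n \<theta> \<omega>))
                          - ereal (empirical_criterion m X n (\<theta>h n \<omega>) \<omega>)) = 0"
    and C: "\<And>n. (\<Sum>i=1..n. f (X i \<omega>)) \<le> C" and c: "0 < (c::real)"
    and f: "\<And>i t. t \<in> U \<Longrightarrow> m t (X i \<omega>) - m (a t) (X i \<omega>) + c \<le> f (X i \<omega>)"
  shows "\<forall>\<^sub>F n in sequentially. \<theta>h n \<omega> \<notin> U"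
proof -
  let ?M = "\<lambda>n t. empirical_criterion m X n t \<omega>"
  have "\<forall>\<^sub>F n in sequentially. (SUP \<theta>. ereal (?M n \<theta>)) - ereal (?M n (\<theta>h n \<omega>)) < ereal (c / 2)"
    using lim c by (intro Limsup_lessD) auto
  moreover have "\<forall>\<^sub>F n in sequentially. C / real n < c / 2"
    using lim_const_over_n[of C] c by (intro order_tendstoD) auto
  ultimately show ?thesis
    using eventually_gt_at_top[of 0]
  proof eventually_elim
    case (elim n)
    show ?case
    proof
      assume U: "\<theta>h n \<omega> \<in> U"
      let ?t = "\<theta>h n \<omega>"
      have "(\<Sum>i=1..n. m ?t (X i \<omega>) - m (a ?t) (X i \<omega>) + c) \<le> (\<Sum>i=1..n. f (X i \<omega>))"
        by (intro sum_mono f U)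
      also have "\<dots> \<le> C" by (rule C)
      finally have "(\<Sum>i=1..n. m ?t (X i \<omega>)) - (\<Sum>i=1..n. m (a ?t) (X i \<omega>)) + n * c \<le> C"
        by (simp add: sum.distrib sum_subtractf)
      then have "((\<Sum>i=1..n. m ?t (X i \<omega>)) - (\<Sum>i=1..n. m (a ?t) (X i \<omega>)) + n * c) / n \<le> C / n"
        by (intro divide_right_mono) auto
      then have "?M n ?t - ?M n (a ?t) + c \<le> C / n"
        using \<open>0 < n\<close> by (simp add: empirical_criterion_def add_divide_distrib diff_divide_distrib)
      then have "c / 2 \<le> ?M n (a ?t) - ?M n ?t" using elim(2) by linarith
      then have "ereal (c / 2) \<le> ereal (?M n (a ?t)) - ereal (?M n ?t)" by simp
      also have "\<dots> \<le> (SUP \<theta>. ereal (?M n \<theta>)) - ereal (?M n ?t)"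
        by (intro ereal_minus_mono SUP_upper) auto
      finally show False using elim(1) by simp
    qed
  qed
qed

text \<open>The exceptional null set depends on the point avoided. Lindelof's property leaves
  countably many open sets, hence one null set; outside it, the compact complement of a neighborhood
  of \<open>l\<close> is covered by finitely many of these sets, all of them eventually
  avoided.\<close>

lemma tendsto_if_locally_eventually_avoids:
  fixes l :: "'t::second_countable_topology" and Y :: "nat \<Rightarrow> 'o \<Rightarrow> 't"
  assumes compact: "compact (UNIV :: 't set)"
    and avoid: "\<And>t. t \<noteq> l \<Longrightarrow> \<exists>U. open U \<and> t \<in> U \<and> (AE \<omega> in M. \<forall>\<^sub>F n in sequentially. Y n \<omega> \<notin> U)"
  shows "AE \<omega> in M. (\<lambda>n. Y n \<omega>) \<longlonglongrightarrow> l"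
proof -
  define F where "F = {U. open U \<and> (AE \<omega> in M. \<forall>\<^sub>F n in sequentially. Y n \<omega> \<notin> U)}"
  obtain F' where F': "F' \<subseteq> F" "countable F'" "\<Union>F' = \<Union>F"
    by (rule Lindelof[of F]) (auto simp: F_def)
  have cover: "- {l} \<subseteq> \<Union>F'" unfolding F'(3) using avoid by (fastforce simp: F_def)
  have "AE \<omega> in M. \<forall>U\<in>F'. \<forall>\<^sub>F n in sequentially. Y n \<omega> \<notin> U"
    using F' by (subst AE_ball_countable) (auto simp: F_def)
  then show ?thesis
  proof eventually_elim
    case (elim \<omega>)
    show ?case
    proof (rule topological_tendstoI)
      fix W assume W: "open W" "l \<in> W"
      have "compact (- W)" using compact_Int_closed[OF compact, of "- W"] W by auto
      moreover have "- W \<subseteq> \<Union>F'" using cover W by auto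
      moreover have "open B" if "B \<in> F'" for B using that F'(1) by (auto simp: F_def)
      ultimately obtain T where T: "T \<subseteq> F'" "finite T" "- W \<subseteq> \<Union>T" by (metis compactE)
      have "\<forall>\<^sub>F n in sequentially. \<forall>U\<in>T. Y n \<omega> \<notin> U"
        using T elim by (intro eventually_ball_finite) auto
      then show "\<forall>\<^sub>F n in sequentially. Y n \<omega> \<in> W"
        by eventually_elim (use T in auto)
    qed
  qed
qed

section \<open>Strong consistency\<close>

theorem theorem2p1:
  fixes S :: "'x measure"
    and P :: "'t::{t2_space, second_countable_topology} \<Rightarrow> 'x measure"
    and \<theta>star :: 't
    and \<Omega> :: "'o measure"
    and X :: "nat \<Rightarrow> 'o \<Rightarrow> 'x"
    and m :: "'t \<Rightarrow> 'x \<Rightarrow> real"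
    and \<theta>h :: "nat \<Rightarrow> 'o \<Rightarrow> 't"
  assumes P_sets: "\<And>\<theta>. sets (P \<theta>) = sets S"
    and P_star: "prob_space (P \<theta>star)"
    and prob: "prob_space \<Omega>"
    and X_indep: "prob_space.indep_vars \<Omega> (\<lambda>_. S) X UNIV"
    and X_law: "\<And>n. distr \<Omega> S (X n) = P \<theta>star"
    and m_meas: "\<And>\<theta>. m \<theta> \<in> borel_measurable S"
    and compact: "compact (UNIV :: 't set)"
    and A1: "AE x in P \<theta>star. continuous_on UNIV (\<lambda>\<theta>. m \<theta> x)"
    and A2: "\<exists>a :: 't \<Rightarrow> 't. continuous_on UNIV a \<and>
              (\<forall>\<theta>. \<theta> \<noteq> \<theta>star \<longrightarrow>
                 (\<exists>V. \<theta> \<in> interior V \<and>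
                      (\<lambda>x. SUP \<theta>'\<in>V. ereal (m \<theta>' x - m (a \<theta>') x)) \<in> L1_plus (P \<theta>star)) \<and>
                 ext_expectation (P \<theta>star) (\<lambda>x. ereal (m \<theta> x - m (a \<theta>) x)) < 0)"
    and est: "asymptotic_M_estimators \<Omega> S m X \<theta>h"
  shows "AE \<omega> in \<Omega>. (\<lambda>n. \<theta>h n \<omega>) \<longlonglongrightarrow> \<theta>star"
proof -
  interpret prob_space \<Omega> by (rule prob)
  obtain a where a: "continuous_on UNIV a"
    and drift_cond: "\<forall>\<theta>. \<theta> \<noteq> \<theta>star \<longrightarrow>
      (\<exists>V. \<theta> \<in> interior V \<and> (\<lambda>x. SUP \<theta>'\<in>V. ereal (m \<theta>' x - m (a \<theta>') x)) \<in> L1_plus (P \<theta>star)) \<and>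
      ext_expectation (P \<theta>star) (\<lambda>x. ereal (m \<theta> x - m (a \<theta>) x)) < 0"
    using A2 by (elim exE conjE) (rule that)
  have X [measurable]: "X i \<in> measurable \<Omega> S" for i
    using X_indep by (auto simp: indep_vars_def)
  have [measurable]: "m \<theta> \<in> borel_measurable (P \<theta>star)" for \<theta>
    using m_meas[of \<theta>] by (simp add: measurable_cong_sets[OF P_sets refl])
  have AE_X: "AE \<omega> in \<Omega>. \<forall>i. Q (X i \<omega>)" if "AE x in P \<theta>star. Q x" for Q
    unfolding AE_all_countable using that by (intro allI AE_distrD[OF X]) (simp only: X_law)
  \<comment> \<open>Continuity of \<open>a\<close> enters here: it makes the compared difference
    itself continuous in the parameter.\<close>
  have cont: "AE x in P \<theta>star. continuous_on UNIV (\<lambda>\<theta>. m \<theta> x - m (a \<theta>) x)"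
    using A1
  proof eventually_elim
    case (elim x)
    then show ?case
      by (intro continuous_on_diff continuous_on_compose2[OF elim a]) auto
  qed
  have "\<exists>U. open U \<and> \<theta> \<in> U \<and> (AE \<omega> in \<Omega>. \<forall>\<^sub>F n in sequentially. \<theta>h n \<omega> \<notin> U)"
    if \<theta>: "\<theta> \<noteq> \<theta>star" for \<theta>
  proof -
    obtain V where V: "\<theta> \<in> interior V"
        "(\<lambda>x. SUP \<theta>'\<in>V. ereal (m \<theta>' x - m (a \<theta>') x)) \<in> L1_plus (P \<theta>star)"
      and neg: "ext_expectation (P \<theta>star) (\<lambda>x. ereal (m \<theta> x - m (a \<theta>) x)) < 0"
      using drift_cond \<theta> by blast
    obtain U f c where U: "open U" "\<theta> \<in> U" and f: "f \<in> borel_measurable (P \<theta>star)" and c: "0 < (c::real)"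
      and drift: "(\<integral>\<^sup>+x. ennreal (f x) \<partial>P \<theta>star) < (\<integral>\<^sup>+x. ennreal (- f x) \<partial>P \<theta>star)"
      and dom: "AE x in P \<theta>star. \<forall>\<theta>'\<in>U. m \<theta>' x - m (a \<theta>') x + c \<le> f x"
      by (rule negative_drift_near[OF P_star _ cont V neg]) measurable
    have "f \<in> borel_measurable S"
      using f by (simp add: measurable_cong_sets[OF P_sets refl])
    then have "AE \<omega> in \<Omega>. \<exists>C. \<forall>n. (\<Sum>i=1..n. f (X i \<omega>)) \<le> C"
      by (rule AE_partial_sums_bounded_above[OF X_indep X_law _ drift])
    moreover have "AE \<omega> in \<Omega>. limsup (\<lambda>n. (SUP \<theta>. ereal (empirical_criterion m X n \<theta> \<omega>))
        - ereal (empirical_criterion m X n (\<theta>h n \<omega>) \<omega>)) = 0"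
      using est by (simp add: asymptotic_M_estimators_def)
    \<comment> \<open>The bounded walk, the estimator property and the domination at all sample
      points \<open>X i\<close> hold on a common almost sure event, where the pathwise argument
      applies.\<close>
    ultimately have "AE \<omega> in \<Omega>. \<forall>\<^sub>F n in sequentially. \<theta>h n \<omega> \<notin> U"
      using AE_X[OF dom]
    proof eventually_elim
      case (elim \<omega>)
      then obtain C where "\<And>n. (\<Sum>i=1..n. f (X i \<omega>)) \<le> C" by blast
      with elim show ?case
        by (intro eventually_maximizer_notin[OF _ _ c, where a=a and f=f and C=C]) auto
    qed
    with U show ?thesis by blast
  qed
  then show ?thesis by (rule tendsto_if_locally_eventually_avoids[OF compact])
qed

end
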